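(* Let $D\subset\mathbb{R}^n$ be closed and convex, let $U=\{\xi_1,\dots,\xi_p\}$ be a finite set, let $h_j:\mathbb{R}^n\times U\to\mathbb{R}$, $j\in\{1,\dots,m\}$, be such that each $h_j(\cdot,\xi_i)$ is continuously differentiable, and let $H_j(x)=\max_{1\le i\le p}h_j(x,\xi_i)$, $H=(H_1,\dots,H_m)^T$. Assume that $\{x^k\}$ is an infinite sequence generated by the projected gradient descent algorithm for $\min_{x\in D}H(x)$ (as described in the context). Then every accumulation point of $\{x^k\}$ is a Pareto critical point for $H$.
   Context: $\nabla h_j(x,\xi_i)$ is the gradient with respect to $x$; $D-\{x\}=\{y-x:y\in D\}$; $\|\cdot\|$ is the Euclidean norm; $I_j(x)=\{i\in\{1,\dots,p\}:h_j(x,\xi_i)=H_j(x)\}$. A point $x\in D$ is Pareto critical for $H$ if there is no $v\in D-\{x\}$ such that $\nabla h_j(x,\xi_i)^Tv<0$ for all $j\in\{1,\dots,m\}$ and all $i\in I_j(x)$. For $x\in D$ and a parameter $\beta$, let $t(x)$ and $\Omega(x)$ be the unique optimal solution and the optimal value of $$\min_{t\in D-\{x\}}\Big(\beta\,\Theta_x(t)+\tfrac12\|t\|^2\Big),\qquad \Theta_x(t)=\max_{1\le j\le m}\ \max_{1\le i\le p}\big\{h_j(x,\xi_i)+\nabla h_j(x,\xi_i)^Tt-H_j(x)\big\}.$$ Projected gradient descent algorithm. Step 1: choose $\epsilon>0$, $\beta\ge1$, $\eta\in(0,1)$, $x^0\in D$; set $k:=0$. Step 2: compute $t^k=t(x^k)$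 and $\Omega(x^k)$. Step 3: if $|\Omega(x^k)|<\epsilon$, stop; otherwise go to Step 4. Step 4: let $\alpha_k$ be the largest $\alpha\in\{1/2^r: r=1,2,3,\dots\}$ such that $$H_j(x^k+\alpha t^k)\le H_j(x^k)+\alpha\,\eta\, H_j^*(x^k,t^k)\quad\text{for all } j\in\{1,\dots,m\},$$ where $H_j^*(x^k,t^k)=\max_{1\le i\le p}\{h_j(x^k,\xi_i)+\nabla h_j(x^k,\xi_i)^Tt^k\}-H_j(x^k)$. Step 5: set $x^{k+1}:=x^k+\alpha_kt^k$, $k:=k+1$, and go to Step 2. *)

theory Defs
  imports "HOL-Analysis.Analysis"
begin

definition grad :: "('a::real_inner \<Rightarrow> real) \<Rightarrow> 'a \<Rightarrow> 'a"
  where "grad f x = (THE g. GDERIV f x :> g)"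

definition C1 :: "('a::real_inner \<Rightarrow> real) \<Rightarrow> bool"
  where "C1 f \<longleftrightarrow> (\<forall>x. f differentiable (at x)) \<and> continuous_on UNIV (grad f)"

text \<open>
  Throughout, \<open>h j x u\<close> stands for $h_j(x,u)$ and \<open>\<xi> 1, \<dots>, \<xi> p\<close> enumerate the uncertainty set.
  The maxima below are taken over \<open>{1..p}\<close> and \<open>{1..m}\<close>; they are meaningful only for
  \<open>p \<ge> 1\<close> and \<open>m \<ge> 1\<close>.
\<close>

definition robust_obj ::
  "nat \<Rightarrow> (nat \<Rightarrow> 'u) \<Rightarrow> (nat \<Rightarrow> real^'n \<Rightarrow> 'u \<Rightarrow> real) \<Rightarrow> nat \<Rightarrow> real^'n \<Rightarrow> real"
  where "robust_obj p \<xi> h j x = (MAX i\<in>{1..p}. h j x (\<xi> i))"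

definition active_set ::
  "nat \<Rightarrow> (nat \<Rightarrow> 'u) \<Rightarrow> (nat \<Rightarrow> real^'n \<Rightarrow> 'u \<Rightarrow> real) \<Rightarrow> nat \<Rightarrow> real^'n \<Rightarrow> nat set"
  where "active_set p \<xi> h j x = {i \<in> {1..p}. h j x (\<xi> i) = robust_obj p \<xi> h j x}"

definition feasible_dirs :: "(real^'n) set \<Rightarrow> real^'n \<Rightarrow> (real^'n) set"
  where "feasible_dirs D x = {y - x | y. y \<in> D}"

definition pareto_critical ::
  "(real^'n) set \<Rightarrow> nat \<Rightarrow> (nat \<Rightarrow> 'u) \<Rightarrow> nat \<Rightarrow> (nat \<Rightarrow> real^'n \<Rightarrow> 'u \<Rightarrow> real) \<Rightarrow> real^'n \<Rightarrow> bool"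
  where "pareto_critical D p \<xi> m h x \<longleftrightarrow> x \<in> D \<and>
    \<not> (\<exists>v \<in> feasible_dirs D x. \<forall>j\<in>{1..m}. \<forall>i \<in> active_set p \<xi> h j x.
          grad (\<lambda>y. h j y (\<xi> i)) x \<bullet> v < 0)"

definition Theta ::
  "nat \<Rightarrow> (nat \<Rightarrow> 'u) \<Rightarrow> nat \<Rightarrow> (nat \<Rightarrow> real^'n \<Rightarrow> 'u \<Rightarrow> real) \<Rightarrow> real^'n \<Rightarrow> real^'n \<Rightarrow> real"
  where "Theta p \<xi> m h x t =
    (MAX j\<in>{1..m}. MAX i\<in>{1..p}.
       h j x (\<xi> i) + grad (\<lambda>y. h j y (\<xi> i)) x \<bullet> t - robust_obj p \<xi> h j x)"

definition subproblem_obj ::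
  "nat \<Rightarrow> (nat \<Rightarrow> 'u) \<Rightarrow> nat \<Rightarrow> (nat \<Rightarrow> real^'n \<Rightarrow> 'u \<Rightarrow> real) \<Rightarrow> real \<Rightarrow> real^'n \<Rightarrow> real^'n \<Rightarrow> real"
  where "subproblem_obj p \<xi> m h \<beta> x t = \<beta> * Theta p \<xi> m h x t + 1/2 * (norm t)\<^sup>2"

text \<open>
  The subproblem objective is continuous and strongly convex, so for nonempty closed convex
  \<open>D\<close> and \<open>\<beta> \<ge> 0\<close> there is exactly one minimizer, and the choice made by
  \<open>arg_min_on\<close> is that minimizer.
\<close>

definition opt_dir ::
  "(real^'n) set \<Rightarrow> nat \<Rightarrow> (nat \<Rightarrow> 'u) \<Rightarrow> nat \<Rightarrow> (nat \<Rightarrow> real^'n \<Rightarrow> 'u \<Rightarrow> real) \<Rightarrow> real \<Rightarrow> real^'n \<Rightarrow> real^'n"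
  where "opt_dir D p \<xi> m h \<beta> x = arg_min_on (subproblem_obj p \<xi> m h \<beta> x) (feasible_dirs D x)"

definition opt_val ::
  "(real^'n) set \<Rightarrow> nat \<Rightarrow> (nat \<Rightarrow> 'u) \<Rightarrow> nat \<Rightarrow> (nat \<Rightarrow> real^'n \<Rightarrow> 'u \<Rightarrow> real) \<Rightarrow> real \<Rightarrow> real^'n \<Rightarrow> real"
  where "opt_val D p \<xi> m h \<beta> x = (INF t\<in>feasible_dirs D x. subproblem_obj p \<xi> m h \<beta> x t)"

definition lin_decrease ::
  "nat \<Rightarrow> (nat \<Rightarrow> 'u) \<Rightarrow> (nat \<Rightarrow> real^'n \<Rightarrow> 'u \<Rightarrow> real) \<Rightarrow> nat \<Rightarrow> real^'n \<Rightarrow> real^'n \<Rightarrow> real"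
  where "lin_decrease p \<xi> h j x t =
    (MAX i\<in>{1..p}. h j x (\<xi> i) + grad (\<lambda>y. h j y (\<xi> i)) x \<bullet> t) - robust_obj p \<xi> h j x"

definition admissible_steps ::
  "nat \<Rightarrow> (nat \<Rightarrow> 'u) \<Rightarrow> nat \<Rightarrow> (nat \<Rightarrow> real^'n \<Rightarrow> 'u \<Rightarrow> real) \<Rightarrow> real \<Rightarrow> real^'n \<Rightarrow> real^'n \<Rightarrow> real set"
  where "admissible_steps p \<xi> m h \<eta> x t =
    {\<alpha> \<in> {1 / 2 ^ r | r::nat. r \<ge> 1}.
       \<forall>j\<in>{1..m}. robust_obj p \<xi> h j (x + \<alpha> *\<^sub>R t)
          \<le> robust_obj p \<xi> h j x + \<alpha> * \<eta> * lin_decrease p \<xi> h j x t}"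

text \<open>
  An infinite run of the algorithm with parameters \<open>\<epsilon>\<close>, \<open>\<beta>\<close>, \<open>\<eta>\<close>: the stopping test
  fails at every iterate, and the step size is the greatest admissible one.
\<close>

definition pgd_infinite_run ::
  "(real^'n) set \<Rightarrow> nat \<Rightarrow> (nat \<Rightarrow> 'u) \<Rightarrow> nat \<Rightarrow> (nat \<Rightarrow> real^'n \<Rightarrow> 'u \<Rightarrow> real)
    \<Rightarrow> real \<Rightarrow> real \<Rightarrow> real \<Rightarrow> (nat \<Rightarrow> real^'n) \<Rightarrow> bool"
  where "pgd_infinite_run D p \<xi> m h \<epsilon> \<beta> \<eta> x \<longleftrightarrow>
    \<epsilon> > 0 \<and> \<beta> \<ge> 1 \<and> 0 < \<eta> \<and> \<eta> < 1 \<and> x 0 \<in> D \<and>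
    (\<forall>k. \<not> \<bar>opt_val D p \<xi> m h \<beta> (x k)\<bar> < \<epsilon> \<and>
         (\<exists>\<alpha> \<in> admissible_steps p \<xi> m h \<eta> (x k) (opt_dir D p \<xi> m h \<beta> (x k)).
            (\<forall>\<alpha>' \<in> admissible_steps p \<xi> m h \<eta> (x k) (opt_dir D p \<xi> m h \<beta> (x k)). \<alpha>' \<le> \<alpha>) \<and>
            x (Suc k) = x k + \<alpha> *\<^sub>R opt_dir D p \<xi> m h \<beta> (x k)))"

definition accumulation_point :: "(nat \<Rightarrow> 'a::metric_space) \<Rightarrow> 'a \<Rightarrow> bool"
  where "accumulation_point x a \<longleftrightarrow> (\<exists>s::nat \<Rightarrow> nat. strict_mono s \<and> (x \<circ> s) \<longlonglongrightarrow> a)"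

end

theory Submission
  imports Defs
begin

text \<open>
  Suppose that an accumulation point \<open>a\<close> is not Pareto critical. The idea is that the
  algorithm then makes a fixed amount of progress at every iterate close to \<open>a\<close>, whereas its
  objective values can only fall to the limit \<open>H 1 a\<close>.

  A direction of common descent at \<open>a\<close>, scaled down until the quadratic term is harmless, gives a
  point \<open>z\<close> of \<open>D\<close> where the subproblem at \<open>a\<close> has a negative objective value
  (\<open>subproblem_negative_if_not_critical\<close>). With the \<^emph>\<open>point\<close> \<open>z\<close> kept fixed, the
  displacement \<open>z - y\<close> is feasible at every \<open>y\<close> in \<open>D\<close>, and its objective value depends
  continuously on \<open>y\<close>. So near \<open>a\<close> the optimal values stay below a negative constant, and
  with them the predicted decreases \<open>lin_decrease\<close> of the chosen directions.
  The chosen directions also stay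
  bounded, because an optimal value is at most 0 and the quadratic term would otherwise dominate
  (\<open>norm_le_if_subproblem_obj_nonpos\<close>).

  For bounded directions whose predicted decrease is bounded away from 0, all sufficiently small
  steps pass the line search, with a threshold common to all base points near \<open>a\<close>
  (\<open>uniform_sufficient_decrease\<close>): the gradients vary little near \<open>a\<close>, and
  the factor \<open>\<eta> < 1\<close> leaves room for the error. Since the search halves from \<open>1/2\<close>
  downwards, the accepted step exceeds half that threshold, and \<open>H 1\<close> drops by at least a constant
  \<open>c > 0\<close> (\<open>local_decrease_near_noncritical\<close>). As \<open>H 1\<close> never increases along the run,
  passing to the limit along a subsequence tending to \<open>a\<close> gives \<open>H 1 a \<le> H 1 a - c\<close>.
\<close>

section \<open>Gradients, finite maxima and attained minima\<close>

text \<open>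
  A derivative of a real-valued function is a linear functional, so its adjoint, applied to 1,
  represents it as an inner product. Uniqueness of derivatives makes this the vector selected by the
  definite description in \<open>grad\<close>.
\<close>

lemma C1_imp_GDERIV_grad:
  fixes f :: "'a::euclidean_space \<Rightarrow> real"
  assumes "C1 f"
  shows "GDERIV f x :> grad f x"
proof -
  obtain f' where f': "(f has_derivative f') (at x)"
    using assms unfolding C1_def differentiable_def by blast
  then have lin: "linear f'"
    by (rule has_derivative_linear)
  have "f' = (\<lambda>v. v \<bullet> adjoint f' 1)"
    using adjoint_works[OF lin] by (force simp: inner_commute)
  then have *: "GDERIV f x :> adjoint f' 1"
    using f' unfolding gderiv_def by metis
  moreover have "g = adjoint f' 1" if "GDERIV f x :> g" for g
  proof -
    have "(\<lambda>v. v \<bullet> g) = (\<lambda>v. v \<bullet> adjoint f' 1)"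
      using has_derivative_unique that * unfolding gderiv_def by blast
    then have "\<forall>v. v \<bullet> g = v \<bullet> adjoint f' 1"
      by (rule fun_cong[THEN allI])
    then show ?thesis
      unfolding vector_eq_ldot .
  qed
  ultimately show ?thesis
    unfolding grad_def by (rule theI)
qed

lemma C1_tendsto_grad: "C1 f \<Longrightarrow> (grad f \<longlongrightarrow> grad f a) (nhds a)"
  unfolding C1_def continuous_on_def tendsto_at_iff_tendsto_nhds[symmetric] by auto

lemma gradient_mean_value:
  fixes f :: "'a::euclidean_space \<Rightarrow> real"
  assumes "C1 f" "0 \<le> a"
  shows "\<exists>s\<in>{0..a}. f (x + a *\<^sub>R t) - f x = a * (grad f (x + s *\<^sub>R t) \<bullet> t)"
proof -
  have "\<exists>s\<in>{0..a}. f (x + a *\<^sub>R t) - f (x + 0 *\<^sub>R t) = (a - 0) *\<^sub>R t \<bullet> grad f (x + s *\<^sub>R t)"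
  proof (rule mvt_very_simple[OF \<open>0 \<le> a\<close>, where f = "\<lambda>s. f (x + s *\<^sub>R t)"
        and f' = "\<lambda>s d. d *\<^sub>R t \<bullet> grad f (x + s *\<^sub>R t)"])
    fix s
    have "(f has_derivative (\<lambda>d. d \<bullet> grad f (x + s *\<^sub>R t))) (at (x + s *\<^sub>R t))"
      using C1_imp_GDERIV_grad[OF assms(1)] unfolding gderiv_def .
    moreover have "((\<lambda>s. x + s *\<^sub>R t) has_derivative (\<lambda>d. d *\<^sub>R t)) (at s within {0..a})"
      by (auto intro!: derivative_eq_intros)
    ultimately show "((\<lambda>s. f (x + s *\<^sub>R t)) has_derivative (\<lambda>d. d *\<^sub>R t \<bullet> grad f (x + s *\<^sub>R t)))
        (at s within {0..a})"
      using has_derivative_compose[of "\<lambda>s. x + s *\<^sub>R t"] by fast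
  qed
  then show ?thesis
    by (simp add: inner_commute)
qed

lemma tendsto_MAX:
  fixes f :: "'i \<Rightarrow> 'b \<Rightarrow> 'c::linorder_topology"
  assumes "finite I" "I \<noteq> {}" "\<And>i. i \<in> I \<Longrightarrow> (f i \<longlongrightarrow> l i) F"
  shows "((\<lambda>x. MAX i\<in>I. f i x) \<longlongrightarrow> (MAX i\<in>I. l i)) F"
  using assms
proof (induction I rule: finite_ne_induct)
  case (insert i I)
  then show ?case
    by (simp add: tendsto_max)
qed simp

text \<open>
  Only the sublevel set of one feasible point matters for minimization, and it is compact; the feasible set
  itself may be unbounded.
\<close>

lemma attains_inf_bounded_sublevel:
  fixes f :: "'a::heine_borel \<Rightarrow> real"
  assumes "closed S" "t0 \<in> S" "continuous_on UNIV f" "bounded {t \<in> S. f t \<le> f t0}"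
  shows "\<exists>t\<in>S. \<forall>u\<in>S. f t \<le> f u"
proof -
  let ?K = "{t \<in> S. f t \<le> f t0}"
  have "?K = S \<inter> {t. f t \<le> f t0}" by blast
  then have "closed ?K"
    using assms(1) closed_Collect_le[OF assms(3) continuous_on_const] by auto
  then have "compact ?K"
    using assms(4) compact_eq_bounded_closed by blast
  moreover have "?K \<noteq> {}" using assms(2) by blast
  moreover have "continuous_on ?K f"
    using assms(3) continuous_on_subset by blast
  ultimately have "\<exists>t\<in>?K. \<forall>u\<in>?K. f t \<le> f u"
    by (rule continuous_attains_inf)
  then obtain t where t: "t \<in> S" "f t \<le> f t0" and min: "\<And>u. \<lbrakk>u \<in> S; f u \<le> f t0\<rbrakk> \<Longrightarrow> f t \<le> f u"
    by blast
  have "f t \<le> f u" if "u \<in> S" for u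
    using t(2) min[OF that] by linarith
  then show ?thesis
    using t(1) by blast
qed

section \<open>The direction subproblem\<close>

locale robust_problem =
  fixes p m :: nat and \<xi> :: "nat \<Rightarrow> 'u" and h :: "nat \<Rightarrow> real^'n \<Rightarrow> 'u \<Rightarrow> real"
  assumes p_pos: "p \<ge> 1" and m_pos: "m \<ge> 1"
    and C1_h: "\<And>j i. \<lbrakk>j \<in> {1..m}; i \<in> {1..p}\<rbrakk> \<Longrightarrow> C1 (\<lambda>y. h j y (\<xi> i))"
begin

abbreviation "scen j i \<equiv> \<lambda>y. h j y (\<xi> i)"
abbreviation "H j \<equiv> robust_obj p \<xi> h j"
abbreviation "\<Theta> \<equiv> Theta p \<xi> m h"
abbreviation "\<Phi> \<equiv> subproblem_obj p \<xi> m h"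
abbreviation "lin j \<equiv> lin_decrease p \<xi> h j"

lemma scenarios_nonempty: "{1..p} \<noteq> {}" and objectives_nonempty: "{1..m} \<noteq> {}"
  using p_pos m_pos by auto

lemma scenario_le_H: "i \<in> {1..p} \<Longrightarrow> scen j i x \<le> H j x"
  unfolding robust_obj_def by (rule Max_ge) auto

lemma H_le_iff: "H j x \<le> c \<longleftrightarrow> (\<forall>i\<in>{1..p}. scen j i x \<le> c)"
  unfolding robust_obj_def using scenarios_nonempty by (subst Max_le_iff) auto

lemma active_index_exists: "\<exists>i\<in>{1..p}. scen j i x = H j x"
proof -
  have "H j x \<in> (\<lambda>i. scen j i x) ` {1..p}"
    unfolding robust_obj_def using scenarios_nonempty by (intro Max_in) auto
  then show ?thesis by force
qed

lemma Theta_le_iff: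
  "\<Theta> x t \<le> c \<longleftrightarrow> (\<forall>j\<in>{1..m}. \<forall>i\<in>{1..p}. scen j i x + grad (scen j i) x \<bullet> t - H j x \<le> c)"
  unfolding Theta_def using scenarios_nonempty objectives_nonempty
  by (subst Max_le_iff; simp)+

lemma Theta_less_iff:
  "\<Theta> x t < c \<longleftrightarrow> (\<forall>j\<in>{1..m}. \<forall>i\<in>{1..p}. scen j i x + grad (scen j i) x \<bullet> t - H j x < c)"
  unfolding Theta_def using scenarios_nonempty objectives_nonempty
  by (subst Max_less_iff; simp)+

lemma lin_decrease_le_iff:
  "lin j x t \<le> c \<longleftrightarrow> (\<forall>i\<in>{1..p}. scen j i x + grad (scen j i) x \<bullet> t - H j x \<le> c)"
  unfolding lin_decrease_def diff_le_eq using scenarios_nonempty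
  by (subst Max_le_iff) auto

lemma lin_decrease_le_Theta: "j \<in> {1..m} \<Longrightarrow> lin j x t \<le> \<Theta> x t"
  using Theta_le_iff[of x t "\<Theta> x t"] by (simp add: lin_decrease_le_iff)

lemma tendsto_scenario:
  assumes "j \<in> {1..m}" "i \<in> {1..p}"
  shows "(scen j i \<longlongrightarrow> scen j i a) (nhds a)"
proof -
  have "isCont (scen j i) a"
    using C1_h[OF assms] unfolding C1_def by (blast intro: differentiable_imp_continuous_within)
  then show ?thesis
    unfolding isCont_def by (rule tendsto_at_iff_tendsto_nhds[THEN iffD1])
qed

lemma tendsto_H: "j \<in> {1..m} \<Longrightarrow> (H j \<longlongrightarrow> H j a) (nhds a)"
  unfolding robust_obj_def using scenarios_nonempty
  by (intro tendsto_MAX tendsto_scenario) auto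

lemma tendsto_subproblem_obj_target:
  "((\<lambda>x. \<Phi> \<beta> x (z - x)) \<longlongrightarrow> \<Phi> \<beta> a (z - a)) (nhds a)"
  unfolding subproblem_obj_def Theta_def using scenarios_nonempty objectives_nonempty
  by (intro tendsto_intros tendsto_MAX tendsto_scenario tendsto_H C1_tendsto_grad C1_h filterlim_ident) auto

lemma continuous_on_subproblem_obj: "continuous_on UNIV (\<Phi> \<beta> x)"
  unfolding subproblem_obj_def Theta_def continuous_on_def
  using scenarios_nonempty objectives_nonempty
  by (intro ballI tendsto_intros tendsto_MAX) auto

lemma subproblem_obj_zero:
  assumes "\<beta> \<ge> 0"
  shows "\<Phi> \<beta> x 0 \<le> 0"
proof -
  have "\<Theta> x 0 \<le> 0"
    unfolding Theta_le_iff using scenario_le_H by auto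
  then show ?thesis
    unfolding subproblem_obj_def using assms by (simp add: mult_nonneg_nonpos)
qed

text \<open>
  At an index \<open>i\<close> active for the first objective, the term inside \<open>Theta\<close> reduces to the inner product
  of the gradient with \<open>t\<close>. A nonpositive objective value therefore forces
  \<open>(norm t)\<^sup>2 / 2 \<le> \<beta> * G * norm t\<close>. The same estimate yields existence of a minimizer and a bound
  on the directions that is uniform in the base point.
\<close>

lemma norm_le_if_subproblem_obj_nonpos:
  assumes "\<beta> \<ge> 0" "\<Phi> \<beta> x t \<le> 0" "\<And>i. i \<in> {1..p} \<Longrightarrow> norm (grad (scen 1 i) x) \<le> G"
  shows "norm t \<le> 2 * \<beta> * G"
proof -
  obtain i where i: "i \<in> {1..p}" "scen 1 i x = H 1 x"
    using active_index_exists by blast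
  have "grad (scen 1 i) x \<bullet> t \<le> \<Theta> x t"
    using Theta_le_iff[of x t "\<Theta> x t"] i m_pos by force
  moreover have "- (grad (scen 1 i) x \<bullet> t) \<le> G * norm t"
    using Cauchy_Schwarz_ineq2[of "grad (scen 1 i) x" t] assms(3)[OF i(1)]
      mult_right_mono[of "norm (grad (scen 1 i) x)" G "norm t"] by (simp add: abs_le_iff)
  ultimately have "- \<Theta> x t \<le> G * norm t" by linarith
  then have "\<beta> * (- \<Theta> x t) \<le> \<beta> * (G * norm t)"
    using assms(1) mult_left_mono by blast
  then have "norm t * norm t \<le> (2 * \<beta> * G) * norm t"
    using assms(2) unfolding subproblem_obj_def by (simp add: power2_eq_square)
  moreover have "0 \<le> G"
    using assms(3)[OF i(1)] norm_ge_zero order_trans by blast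
  ultimately show ?thesis
    using assms(1) by (cases "t = 0") (auto simp: mult_le_cancel_right)
qed

text \<open>
  The objective is at most 0 at the feasible direction 0, and the sublevel set at level 0 is bounded, so a
  minimizer exists; hence the choice made by \<open>arg_min_on\<close> is a genuine minimizer.
\<close>

lemma opt_dir_minimizes:
  assumes "closed D" "x \<in> D" "\<beta> \<ge> 0"
  shows "opt_dir D p \<xi> m h \<beta> x \<in> feasible_dirs D x"
    and "u \<in> feasible_dirs D x \<Longrightarrow> \<Phi> \<beta> x (opt_dir D p \<xi> m h \<beta> x) \<le> \<Phi> \<beta> x u"
proof -
  let ?S = "feasible_dirs D x"
  have S: "?S = (\<lambda>y. y - x) ` D"
    unfolding feasible_dirs_def by blast
  have "closed ?S"
    using closed_translation_subtract[OF assms(1)] unfolding S .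
  moreover have "0 \<in> ?S"
    using assms(2) unfolding S by force
  moreover have "bounded {t \<in> ?S. \<Phi> \<beta> x t \<le> \<Phi> \<beta> x 0}"
  proof (rule boundedI)
    fix t assume "t \<in> {t \<in> ?S. \<Phi> \<beta> x t \<le> \<Phi> \<beta> x 0}"
    then have "\<Phi> \<beta> x t \<le> 0"
      using subproblem_obj_zero[OF assms(3)] order_trans by blast
    then show "norm t \<le> 2 * \<beta> * (MAX i\<in>{1..p}. norm (grad (scen 1 i) x))"
      by (rule norm_le_if_subproblem_obj_nonpos[OF assms(3)]) auto
  qed
  ultimately have "\<exists>t\<in>?S. \<forall>u\<in>?S. \<Phi> \<beta> x t \<le> \<Phi> \<beta> x u"
    using attains_inf_bounded_sublevel[OF _ _ continuous_on_subproblem_obj] by blast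
  then have "\<exists>t. is_arg_min (\<Phi> \<beta> x) (\<lambda>t. t \<in> ?S) t"
    unfolding is_arg_min_linorder by blast
  then have "is_arg_min (\<Phi> \<beta> x) (\<lambda>t. t \<in> ?S) (opt_dir D p \<xi> m h \<beta> x)"
    unfolding opt_dir_def arg_min_on_def arg_min_def by (rule someI_ex)
  then show "opt_dir D p \<xi> m h \<beta> x \<in> ?S"
    and "u \<in> ?S \<Longrightarrow> \<Phi> \<beta> x (opt_dir D p \<xi> m h \<beta> x) \<le> \<Phi> \<beta> x u"
    unfolding is_arg_min_linorder by blast+
qed

text \<open>
  Moving a fraction \<open>s\<close> along a common descent direction \<open>v\<close> of the active scenarios, an active
  term is negative of first order in \<open>s\<close> and beats the second-order term \<open>(norm (s *\<^sub>R v))\<^sup>2 / 2\<close>.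
  An inactive term starts from the negative gap \<open>scen j i a - H j a\<close> and remains negative for small
  \<open>s\<close>. There are finitely many terms, and convexity keeps \<open>a + s *\<^sub>R v\<close> in \<open>D\<close>.
\<close>

lemma subproblem_negative_if_not_critical:
  assumes "convex D" "a \<in> D" "\<not> pareto_critical D p \<xi> m h a" "\<beta> > 0"
  shows "\<exists>z\<in>D. \<Phi> \<beta> a (z - a) < 0"
proof -
  obtain y where y: "y \<in> D" and
    descent: "\<And>j i. \<lbrakk>j \<in> {1..m}; i \<in> active_set p \<xi> h j a\<rbrakk> \<Longrightarrow> grad (scen j i) a \<bullet> (y - a) < 0"
    using assms(2,3) unfolding pareto_critical_def feasible_dirs_def by auto
  define v where "v = y - a"
  let ?q = "\<lambda>j i s. scen j i a + grad (scen j i) a \<bullet> (s *\<^sub>R v) - H j a"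
  have "\<forall>\<^sub>F s in at_right 0. \<beta> * ?q j i s + 1/2 * (norm (s *\<^sub>R v))\<^sup>2 < 0"
    if ji: "j \<in> {1..m}" "i \<in> {1..p}" for j i
  proof (cases "scen j i a = H j a")
    case True
    then have neg: "\<beta> * (grad (scen j i) a \<bullet> v) < 0"
      using descent[of j i] ji assms(4) unfolding active_set_def v_def by (simp add: mult_pos_neg)
    have "((\<lambda>s. \<beta> * (grad (scen j i) a \<bullet> v) + 1/2 * s * (norm v)\<^sup>2) \<longlongrightarrow>
        \<beta> * (grad (scen j i) a \<bullet> v) + 1/2 * 0 * (norm v)\<^sup>2) (at_right 0)"
      by (intro tendsto_intros)
    then have "\<forall>\<^sub>F s in at_right 0. \<beta> * (grad (scen j i) a \<bullet> v) + 1/2 * s * (norm v)\<^sup>2 < 0"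
      using neg by (intro order_tendstoD(2)) auto
    moreover have "\<forall>\<^sub>F s in at_right (0::real). 0 < s"
      by (rule eventually_at_right_less)
    ultimately show ?thesis
    proof eventually_elim
      case (elim s)
      then have "s * (\<beta> * (grad (scen j i) a \<bullet> v) + 1/2 * s * (norm v)\<^sup>2) < 0"
        by (simp add: mult_pos_neg)
      then show ?case
        using True by (simp add: algebra_simps power2_eq_square)
    qed
  next
    case False
    have "((\<lambda>s. \<beta> * ?q j i s + 1/2 * (norm (s *\<^sub>R v))\<^sup>2) \<longlongrightarrow>
        \<beta> * ?q j i 0 + 1/2 * (norm (0 *\<^sub>R v))\<^sup>2) (at_right 0)"
      by (intro tendsto_intros)
    moreover have "\<beta> * ?q j i 0 + 1/2 * (norm (0 *\<^sub>R v))\<^sup>2 < 0"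
      using False scenario_le_H[OF ji(2), of j a] assms(4) by (simp add: mult_pos_neg)
    ultimately show ?thesis
      by (rule order_tendstoD(2))
  qed
  then have "\<forall>\<^sub>F s in at_right 0. \<forall>j\<in>{1..m}. \<forall>i\<in>{1..p}. \<beta> * ?q j i s + 1/2 * (norm (s *\<^sub>R v))\<^sup>2 < 0"
    by (intro eventually_ball_finite ballI finite_atLeastAtMost)
  moreover have "\<forall>\<^sub>F s in at_right (0::real). 0 < s \<and> s < 1"
    using eventually_at_right_real[of 0 1] by simp
  ultimately have "\<forall>\<^sub>F s in at_right 0. (0 < s \<and> s < 1) \<and>
      (\<forall>j\<in>{1..m}. \<forall>i\<in>{1..p}. \<beta> * ?q j i s + 1/2 * (norm (s *\<^sub>R v))\<^sup>2 < 0)"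
    by eventually_elim blast
  from eventually_happens'[OF trivial_limit_at_right_real this] obtain s where s: "0 < s" "s < 1"
    and q: "\<And>j i. \<lbrakk>j \<in> {1..m}; i \<in> {1..p}\<rbrakk> \<Longrightarrow> \<beta> * ?q j i s + 1/2 * (norm (s *\<^sub>R v))\<^sup>2 < 0"
    by blast
  have "\<Theta> a (s *\<^sub>R v) < - (1/2 * (norm (s *\<^sub>R v))\<^sup>2) / \<beta>"
    unfolding Theta_less_iff
  proof (intro ballI)
    fix j i assume "j \<in> {1..m}" "i \<in> {1..p}"
    then have "\<beta> * ?q j i s < - (1/2 * (norm (s *\<^sub>R v))\<^sup>2)"
      using q by fastforce
    then show "?q j i s < - (1/2 * (norm (s *\<^sub>R v))\<^sup>2) / \<beta>"
      unfolding pos_less_divide_eq[OF assms(4)] by (simp only: mult.commute)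
  qed
  then have "\<Phi> \<beta> a (s *\<^sub>R v) < 0"
    unfolding subproblem_obj_def using assms(4) by (simp add: field_simps)
  moreover have "a + s *\<^sub>R v \<in> D"
    using convexD_alt[OF assms(1,2) y, of s] s unfolding v_def by (simp add: algebra_simps)
  ultimately show ?thesis
    by (intro bexI[of _ "a + s *\<^sub>R v"]) auto
qed

section \<open>Step sizes near a fixed point\<close>

text \<open>
  By the mean value theorem each scenario changes by the gradient at an intermediate point times the
  step. Near \<open>xs\<close> that gradient differs from the one at \<open>x\<close> by so little that the error is
  at most the share \<open>(1 - \<eta>) * (- lin j x t)\<close> of the predicted decrease which the test gives away.
  The linearized value itself is a convex combination, with weights \<open>1 - a\<close> and \<open>a\<close>, of
  \<open>scen j i x \<le> H j x\<close> and of the full linearized value, which is at most \<open>H j x + lin j x t\<close>.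
\<close>

lemma uniform_sufficient_decrease:
  assumes "\<eta> < 1" "\<delta> > 0"
  shows "\<exists>a0>0. a0 \<le> 1/2 \<and> (\<forall>\<^sub>F x in nhds xs. \<forall>t a j. norm t \<le> M \<longrightarrow> 0 < a \<longrightarrow> a \<le> a0 \<longrightarrow>
    j \<in> {1..m} \<longrightarrow> lin j x t \<le> - \<delta> \<longrightarrow> H j (x + a *\<^sub>R t) \<le> H j x + a * \<eta> * lin j x t)"
proof -
  define N where "N = \<bar>M\<bar> + 1"
  have N: "N > 0" "M \<le> N"
    unfolding N_def by auto
  \<comment> \<open>Twice this accuracy, times any admissible \<open>norm t\<close>, is at most \<open>(1 - \<eta>) * \<delta>\<close>.\<close>
  define e where "e = (1 - \<eta>) * \<delta> / (2 * N)"
  have "e > 0"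
    using assms N unfolding e_def by simp
  have "\<forall>\<^sub>F y in nhds xs. dist (grad (scen j i) y) (grad (scen j i) xs) < e"
    if "j \<in> {1..m}" "i \<in> {1..p}" for j i
    using tendstoD[OF C1_tendsto_grad[OF C1_h[OF that]] \<open>e > 0\<close>] .
  then have "\<forall>\<^sub>F y in nhds xs. \<forall>j\<in>{1..m}. \<forall>i\<in>{1..p}.
      dist (grad (scen j i) y) (grad (scen j i) xs) < e"
    by (intro eventually_ball_finite ballI finite_atLeastAtMost)
  then obtain r where r: "r > 0" and
    near: "\<And>y j i. \<lbrakk>dist y xs < r; j \<in> {1..m}; i \<in> {1..p}\<rbrakk>
      \<Longrightarrow> dist (grad (scen j i) y) (grad (scen j i) xs) < e"
    unfolding eventually_nhds_metric by blast
  \<comment> \<open>Steps up to this size move a point of the ball of radius \<open>r / 2\<close> by at most \<open>r / 2\<close>.\<close>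
  define a0 where "a0 = min (1/2) (r / (2 * N))"
  have "a0 \<le> r / (2 * N)"
    unfolding a0_def by simp
  then have "a0 * (2 * N) \<le> r"
    by (subst (asm) pos_le_divide_eq) (use N in auto)
  then have a0_r: "a0 * N \<le> r / 2"
    by (simp add: algebra_simps)
  have a0: "0 < a0" "a0 \<le> 1/2"
    unfolding a0_def using r N by (simp, intro min.cobounded1)
  have "H j (x + a *\<^sub>R t) \<le> H j x + a * \<eta> * lin j x t"
    if x: "dist x xs < r / 2" and t: "norm t \<le> M" and a: "0 < a" "a \<le> a0"
      and j: "j \<in> {1..m}" and dec: "lin j x t \<le> - \<delta>" for x t a j
    unfolding H_le_iff
  proof
    fix i assume i: "i \<in> {1..p}"
    let ?f = "scen j i"
    obtain s where s: "s \<in> {0..a}" and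
      mvt: "?f (x + a *\<^sub>R t) - ?f x = a * (grad ?f (x + s *\<^sub>R t) \<bullet> t)"
      using gradient_mean_value[OF C1_h[OF j i], of a x t] a by auto
    have "norm (s *\<^sub>R t) \<le> a0 * N"
      using s a t N by (auto intro!: mult_mono)
    then have "dist (x + s *\<^sub>R t) xs < r"
      using x a0_r norm_triangle_ineq[of "x - xs" "s *\<^sub>R t"]
      by (simp add: dist_norm algebra_simps)
    moreover have "dist x xs < r"
      using x r by simp
    ultimately have "dist (grad ?f (x + s *\<^sub>R t)) (grad ?f xs) < e"
      and "dist (grad ?f x) (grad ?f xs) < e"
      using near[OF _ j i] by auto
    then have "dist (grad ?f (x + s *\<^sub>R t)) (grad ?f x) < 2 * e"
      using dist_triangle2[of "grad ?f (x + s *\<^sub>R t)" "grad ?f x" "grad ?f xs"] by linarith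
    then have "(grad ?f (x + s *\<^sub>R t) - grad ?f x) \<bullet> t \<le> 2 * e * N"
      using t N \<open>e > 0\<close> norm_cauchy_schwarz[of "grad ?f (x + s *\<^sub>R t) - grad ?f x" t]
        mult_mono[of "norm (grad ?f (x + s *\<^sub>R t) - grad ?f x)" "2 * e" "norm t" N]
      by (simp add: dist_norm)
    also have "\<dots> = (1 - \<eta>) * \<delta>"
      using N unfolding e_def by simp
    also have "\<dots> \<le> (1 - \<eta>) * (- lin j x t)"
      using assms(1) dec by (intro mult_left_mono) auto
    finally have err: "(grad ?f (x + s *\<^sub>R t) - grad ?f x) \<bullet> t \<le> (1 - \<eta>) * (- lin j x t)" .
    have "?f x + grad ?f x \<bullet> t - H j x \<le> lin j x t"
      using lin_decrease_le_iff[of j x t "lin j x t"] i by simp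
    then have "a * (?f x + grad ?f x \<bullet> t) \<le> a * (H j x + lin j x t)"
      using a by (intro mult_left_mono) auto
    moreover have "(1 - a) * ?f x \<le> (1 - a) * H j x"
      using a a0 scenario_le_H[OF i] by (intro mult_left_mono) auto
    moreover have "a * ((grad ?f (x + s *\<^sub>R t) - grad ?f x) \<bullet> t) \<le> a * ((1 - \<eta>) * (- lin j x t))"
      using err a by (intro mult_left_mono) auto
    ultimately show "?f (x + a *\<^sub>R t) \<le> H j x + a * \<eta> * lin j x t"
      using mvt by (simp add: algebra_simps)
  qed
  then have "\<forall>\<^sub>F x in nhds xs. \<forall>t a j. norm t \<le> M \<longrightarrow> 0 < a \<longrightarrow> a \<le> a0 \<longrightarrow>
    j \<in> {1..m} \<longrightarrow> lin j x t \<le> - \<delta> \<longrightarrow> H j (x + a *\<^sub>R t) \<le> H j x + a * \<eta> * lin j x t"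
    unfolding eventually_nhds_metric using r by (intro exI[of _ "r / 2"]) auto
  then show ?thesis
    using a0 by blast
qed

text \<open>
  If the accepted step were at most \<open>a0 / 2 \<le> 1 / 4\<close>, its double would still be one of the trial
  steps \<open>1/2, 1/4, \<dots>\<close> and would be at most \<open>a0\<close>, hence be admissible too.
\<close>

lemma greatest_admissible_step_gt:
  assumes "\<alpha> \<in> admissible_steps p \<xi> m h \<eta> x t"
    and max: "\<And>\<alpha>'. \<alpha>' \<in> admissible_steps p \<xi> m h \<eta> x t \<Longrightarrow> \<alpha>' \<le> \<alpha>"
    and "a0 \<le> 1/2"
    and ok: "\<And>a j. \<lbrakk>0 < a; a \<le> a0; j \<in> {1..m}\<rbrakk> \<Longrightarrow> H j (x + a *\<^sub>R t) \<le> H j x + a * \<eta> * lin j x t"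
  shows "a0 / 2 < \<alpha>"
proof (rule ccontr)
  assume small: "\<not> a0 / 2 < \<alpha>"
  obtain r where r: "r \<ge> 1" "\<alpha> = 1 / 2 ^ r"
    using assms(1) unfolding admissible_steps_def by blast
  have "r \<noteq> 1"
    using small r assms(3) by auto
  then have r2: "r - 1 \<ge> 1" "2 * \<alpha> = 1 / 2 ^ (r - 1)"
    using r by (auto simp: power_eq_if)
  have pos: "\<alpha> > 0"
    using r by simp
  have "2 * \<alpha> \<in> admissible_steps p \<xi> m h \<eta> x t"
    unfolding admissible_steps_def using r2 ok[of "2 * \<alpha>"] small pos by auto
  then show False
    using max pos by fastforce
qed

section \<open>Infinite runs\<close>

lemma pgd_iterate_in_domain:
  assumes "closed D" "convex D" "pgd_infinite_run D p \<xi> m h \<epsilon> \<beta> \<eta> x"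
  shows "x k \<in> D"
proof (induction k)
  case 0
  then show ?case
    using assms(3) unfolding pgd_infinite_run_def by blast
next
  case (Suc k)
  let ?t = "opt_dir D p \<xi> m h \<beta> (x k)"
  obtain \<alpha> where "\<alpha> \<in> admissible_steps p \<xi> m h \<eta> (x k) ?t" and step: "x (Suc k) = x k + \<alpha> *\<^sub>R ?t"
    using assms(3) unfolding pgd_infinite_run_def by blast
  then have \<alpha>: "0 \<le> \<alpha>" "\<alpha> \<le> 1"
    unfolding admissible_steps_def by auto
  have "\<beta> \<ge> 0"
    using assms(3) unfolding pgd_infinite_run_def by simp
  then obtain y where y: "y \<in> D" "?t = y - x k"
    using opt_dir_minimizes(1)[OF assms(1) Suc.IH] unfolding feasible_dirs_def by blast
  then show ?case
    using convexD_alt[OF assms(2) Suc.IH y(1) \<alpha>] unfolding step y(2) by (simp add: algebra_simps)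
qed

text \<open>
  Any feasible target \<open>z\<close> bounds the predicted decrease of the optimal direction. Expressing the
  competitor through its target, and not as a direction, lets the same \<open>z\<close> serve at all base points.
\<close>

lemma lin_decrease_opt_dir_le:
  assumes "closed D" "x \<in> D" "z \<in> D" "\<beta> > 0" "j \<in> {1..m}"
  shows "lin j x (opt_dir D p \<xi> m h \<beta> x) \<le> \<Phi> \<beta> x (z - x) / \<beta>"
proof -
  let ?t = "opt_dir D p \<xi> m h \<beta> x"
  have "\<beta> * \<Theta> x ?t \<le> \<Phi> \<beta> x ?t"
    unfolding subproblem_obj_def by simp
  also have "\<dots> \<le> \<Phi> \<beta> x (z - x)"
    using assms by (intro opt_dir_minimizes(2)) (auto simp: feasible_dirs_def)
  finally have "\<Theta> x ?t \<le> \<Phi> \<beta> x (z - x) / \<beta>"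
    using assms(4) by (simp add: field_simps)
  then show ?thesis
    using lin_decrease_le_Theta[OF assms(5)] order_trans by blast
qed

lemma pgd_step_decrease:
  assumes "closed D" "convex D" and run: "pgd_infinite_run D p \<xi> m h \<epsilon> \<beta> \<eta> x"
  obtains \<alpha> where
    "\<alpha> > 0"
    "\<alpha> \<in> admissible_steps p \<xi> m h \<eta> (x k) (opt_dir D p \<xi> m h \<beta> (x k))"
    "\<And>\<alpha>'. \<alpha>' \<in> admissible_steps p \<xi> m h \<eta> (x k) (opt_dir D p \<xi> m h \<beta> (x k)) \<Longrightarrow> \<alpha>' \<le> \<alpha>"
    "\<And>j. j \<in> {1..m} \<Longrightarrow> H j (x (Suc k)) \<le> H j (x k)
        + \<alpha> * \<eta> * lin j (x k) (opt_dir D p \<xi> m h \<beta> (x k))"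
proof -
  let ?t = "opt_dir D p \<xi> m h \<beta> (x k)"
  obtain \<alpha> where \<alpha>: "\<alpha> \<in> admissible_steps p \<xi> m h \<eta> (x k) ?t"
    and max: "\<forall>\<alpha>' \<in> admissible_steps p \<xi> m h \<eta> (x k) ?t. \<alpha>' \<le> \<alpha>"
    and step: "x (Suc k) = x k + \<alpha> *\<^sub>R ?t"
    using run unfolding pgd_infinite_run_def by blast
  have "\<alpha> > 0"
    and "\<And>j. j \<in> {1..m} \<Longrightarrow> H j (x (Suc k)) \<le> H j (x k) + \<alpha> * \<eta> * lin j (x k) ?t"
    using \<alpha> unfolding admissible_steps_def step by auto
  then show thesis
    using that \<alpha> max by blast
qed

lemma pgd_decreasing:
  assumes "closed D" "convex D" and run: "pgd_infinite_run D p \<xi> m h \<epsilon> \<beta> \<eta> x" and j: "j \<in> {1..m}"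
  shows "decseq (\<lambda>k. H j (x k))"
proof (rule decseq_SucI)
  fix k
  have par: "\<beta> > 0" "\<eta> > 0"
    using run unfolding pgd_infinite_run_def by auto
  note xk = pgd_iterate_in_domain[OF assms(1-3), of k]
  obtain \<alpha> where \<alpha>: "\<alpha> > 0" "H j (x (Suc k)) \<le> H j (x k)
        + \<alpha> * \<eta> * lin j (x k) (opt_dir D p \<xi> m h \<beta> (x k))"
    using pgd_step_decrease[OF assms(1-3), of k] j by metis
  have "lin j (x k) (opt_dir D p \<xi> m h \<beta> (x k)) \<le> \<Phi> \<beta> (x k) 0 / \<beta>"
    using lin_decrease_opt_dir_le[OF assms(1) xk xk par(1) j] by simp
  also have "\<dots> \<le> 0"
    using subproblem_obj_zero par(1) by (simp add: divide_le_0_iff)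
  finally show "H j (x (Suc k)) \<le> H j (x k)"
    using \<alpha> par(2) mult_nonneg_nonpos[of "\<alpha> * \<eta>"] by (smt (verit) mult_pos_pos)
qed

text \<open>
  The constant \<open>c\<close> is the product of three uniform lower bounds: \<open>a0 / 2\<close> for the step size,
  \<open>\<eta>\<close> for the fraction of the predicted decrease that the line search guarantees, and \<open>\<delta>\<close> for the predicted
  decrease itself. The bound refers to the position of an iterate and not to its index, so it applies
  along any subsequence that tends to \<open>a\<close>.
\<close>

lemma local_decrease_near_noncritical:
  assumes "closed D" "convex D" and run: "pgd_infinite_run D p \<xi> m h \<epsilon> \<beta> \<eta> x"
    and "a \<in> D" "\<not> pareto_critical D p \<xi> m h a"
  shows "\<exists>c>0. \<forall>\<^sub>F y in nhds a. \<forall>k. x k = y \<longrightarrow> H 1 (x (Suc k)) \<le> H 1 (x k) - c"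
proof -
  have par: "\<beta> > 0" "0 < \<eta>" "\<eta> < 1"
    using run unfolding pgd_infinite_run_def by auto
  obtain z where z: "z \<in> D" "\<Phi> \<beta> a (z - a) < 0"
    using subproblem_negative_if_not_critical[OF assms(2,4,5) par(1)] by blast
  \<comment> \<open>Half of the bound available at \<open>a\<close>, so that it persists in a neighbourhood of \<open>a\<close>.\<close>
  define \<delta> where "\<delta> = - \<Phi> \<beta> a (z - a) / (2 * \<beta>)"
  have \<delta>: "\<delta> > 0"
    using z par unfolding \<delta>_def by (simp add: divide_neg_pos)
  have neg: "\<forall>\<^sub>F y in nhds a. \<Phi> \<beta> y (z - y) < - \<delta> * \<beta>"
  proof -
    have "\<Phi> \<beta> a (z - a) < - \<delta> * \<beta>"
      using z par by (simp add: \<delta>_def)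
    then show ?thesis
      by (rule order_tendstoD(2)[OF tendsto_subproblem_obj_target])
  qed
  \<comment> \<open>Strictly above the gradient norms at \<open>a\<close>, hence above those at nearby points.\<close>
  define G where "G = (MAX i\<in>{1..p}. norm (grad (scen 1 i) a)) + 1"
  have grad: "\<forall>\<^sub>F y in nhds a. \<forall>i\<in>{1..p}. norm (grad (scen 1 i) y) < G"
  proof (intro eventually_ball_finite ballI finite_atLeastAtMost)
    fix i assume i: "i \<in> {1..p}"
    then have "((\<lambda>y. norm (grad (scen 1 i) y)) \<longlongrightarrow> norm (grad (scen 1 i) a)) (nhds a)"
      using m_pos by (intro tendsto_norm C1_tendsto_grad C1_h) auto
    moreover have "norm (grad (scen 1 i) a) < G"
      unfolding G_def using i by (intro le_less_trans[OF Max_ge less_add_one]) auto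
    ultimately show "\<forall>\<^sub>F y in nhds a. norm (grad (scen 1 i) y) < G"
      by (rule order_tendstoD(2))
  qed
  obtain a0 where a0: "a0 > 0" "a0 \<le> 1/2" and
    armijo: "\<forall>\<^sub>F y in nhds a. \<forall>t s j. norm t \<le> 2 * \<beta> * G \<longrightarrow> 0 < s \<longrightarrow> s \<le> a0 \<longrightarrow>
      j \<in> {1..m} \<longrightarrow> lin j y t \<le> - \<delta> \<longrightarrow> H j (y + s *\<^sub>R t) \<le> H j y + s * \<eta> * lin j y t"
    using uniform_sufficient_decrease[OF par(3) \<delta>, of "2 * \<beta> * G" a] by (elim exE conjE) (rule that)
  have "\<forall>\<^sub>F y in nhds a. \<forall>k. x k = y \<longrightarrow> H 1 (x (Suc k)) \<le> H 1 (x k) - a0 / 2 * \<eta> * \<delta>"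
    using neg grad armijo
  proof eventually_elim
    case (elim y)
    show ?case
    proof (intro allI impI)
      fix k assume k: "x k = y"
      note yD = pgd_iterate_in_domain[OF assms(1-3), of k, unfolded k]
      define t where "t = opt_dir D p \<xi> m h \<beta> y"
      have one: "1 \<in> {1..m}"
        using m_pos by simp
      have dec: "lin j y t \<le> - \<delta>" if "j \<in> {1..m}" for j
      proof -
        have "lin j y t \<le> \<Phi> \<beta> y (z - y) / \<beta>"
          unfolding t_def using lin_decrease_opt_dir_le[OF assms(1) yD z(1) par(1) that] .
        also have "\<dots> \<le> - \<delta>"
          using elim(1) par(1) by (simp add: pos_divide_le_eq)
        finally show ?thesis .
      qed
      have "\<Phi> \<beta> y t \<le> \<Phi> \<beta> y (z - y)"
        unfolding t_def using z(1) par(1)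
        by (intro opt_dir_minimizes(2)[OF assms(1) yD]) (auto simp: feasible_dirs_def)
      then have "\<Phi> \<beta> y t \<le> 0"
        using elim(1) mult_pos_pos[OF \<delta> par(1)] by simp
      then have tG: "norm t \<le> 2 * \<beta> * G"
        using par(1) elim(2) by (intro norm_le_if_subproblem_obj_nonpos) (auto intro: less_imp_le)
      obtain \<alpha> where \<alpha>: "\<alpha> \<in> admissible_steps p \<xi> m h \<eta> y t"
        "\<And>\<alpha>'. \<alpha>' \<in> admissible_steps p \<xi> m h \<eta> y t \<Longrightarrow> \<alpha>' \<le> \<alpha>"
        "H 1 (x (Suc k)) \<le> H 1 y + \<alpha> * \<eta> * lin 1 y t"
        using pgd_step_decrease[OF assms(1-3), of k] one unfolding k t_def by metis
      have "a0 / 2 < \<alpha>"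
        using greatest_admissible_step_gt[OF \<alpha>(1,2) a0(2)] elim(3) tG dec by blast
      then have "a0 / 2 * \<eta> * \<delta> \<le> \<alpha> * \<eta> * (- lin 1 y t)"
        using dec[OF one] a0 par \<delta> by (intro mult_mono) auto
      then show "H 1 (x (Suc k)) \<le> H 1 (x k) - a0 / 2 * \<eta> * \<delta>"
        using \<alpha>(3) k by simp
    qed
  qed
  moreover have "a0 / 2 * \<eta> * \<delta> > 0"
    using a0 par \<delta> by simp
  ultimately show ?thesis by blast
qed

lemma accumulation_point_pareto_critical:
  assumes "closed D" "convex D" and run: "pgd_infinite_run D p \<xi> m h \<epsilon> \<beta> \<eta> x"
    and "accumulation_point x a"
  shows "pareto_critical D p \<xi> m h a"
proof (rule ccontr)
  assume noncrit: "\<not> pareto_critical D p \<xi> m h a"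
  obtain s where s: "strict_mono s" and lim: "(\<lambda>k. x (s k)) \<longlonglongrightarrow> a"
    using assms(4) unfolding accumulation_point_def comp_def by blast
  have "a \<in> D"
    using closed_sequentially[OF assms(1) _ lim] pgd_iterate_in_domain[OF assms(1-3)] by blast
  then obtain c where c: "c > 0" and
    dec: "\<forall>\<^sub>F y in nhds a. \<forall>k. x k = y \<longrightarrow> H 1 (x (Suc k)) \<le> H 1 (x k) - c"
    using local_decrease_near_noncritical[OF assms(1-3)] noncrit by blast
  have one: "1 \<in> {1..m}"
    using m_pos by simp
  have "\<forall>\<^sub>F k in sequentially. H 1 (x (s (Suc k))) \<le> H 1 (x (s k)) - c"
    using eventually_compose_filterlim[OF dec lim]
  proof eventually_elim
    case (elim k)
    have "s k < s (Suc k)"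
      using s by (simp add: strict_mono_Suc_iff)
    then have "H 1 (x (s (Suc k))) \<le> H 1 (x (Suc (s k)))"
      using decseqD[OF pgd_decreasing[OF assms(1-3) one], of "Suc (s k)" "s (Suc k)"] by simp
    then show ?case
      using elim by force
  qed
  moreover have Hlim: "(\<lambda>k. H 1 (x (s k))) \<longlonglongrightarrow> H 1 a"
    by (rule filterlim_compose[OF tendsto_H[OF one] lim])
  then have "(\<lambda>k. H 1 (x (s (Suc k)))) \<longlonglongrightarrow> H 1 a"
    by (rule LIMSEQ_Suc)
  moreover have "(\<lambda>k. H 1 (x (s k)) - c) \<longlonglongrightarrow> H 1 a - c"
    using Hlim by (intro tendsto_intros)
  ultimately have "H 1 a \<le> H 1 a - c"
    using tendsto_le[OF sequentially_bot] by blast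
  then show False
    using c by simp
qed

end

theorem theorem3p4:
  fixes D :: "(real^'n) set"
    and U :: "'u set" and \<xi> :: "nat \<Rightarrow> 'u" and p m :: nat
    and h :: "nat \<Rightarrow> real^'n \<Rightarrow> 'u \<Rightarrow> real"
    and \<epsilon> \<beta> \<eta> :: real
    and x :: "nat \<Rightarrow> real^'n" and xstar :: "real^'n"
  assumes "closed D" and "convex D"
    and "p \<ge> 1" and "m \<ge> 1"
    and "U = \<xi> ` {1..p}"
    and "\<And>j u. j \<in> {1..m} \<Longrightarrow> u \<in> U \<Longrightarrow> C1 (\<lambda>y. h j y u)"
    and "pgd_infinite_run D p \<xi> m h \<epsilon> \<beta> \<eta> x"
    and "accumulation_point x xstar"
  shows "pareto_critical D p \<xi> m h xstar"
proof -
  interpret robust_problem p m \<xi> h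
    using assms(3-6) by unfold_locales auto
  show ?thesis
    using accumulation_point_pareto_critical[OF assms(1,2,7,8)] .
qed

end
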